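(* If $s\ge 2$ is an even integer, then $$\mathrm{Rs}(K_{1,s})=(\mathrm{R}(K_{1,s})-1)^2+1=(2s-2)^2+1 .$$
   Context: All graphs are finite and simple. $K_{1,s}$ is the star with $s$ edges. A (not necessarily induced) subgraph $H$ of a host graph $F$ is singular if the degrees $d_F(v)$, $v\in V(H)$, taken in $F$, are all equal or pairwise distinct. In an edge 2-coloring of $K_m$, the host graph of a color is the spanning graph on all $m$ vertices formed by the edges of that color. The singular Ramsey number $\mathrm{Rs}(G)$ is the smallest integer $N$ such that for every $m\ge N$ and every 2-coloring of the edges of $K_m$, at least one of the two color graphs contains a singular subgraph isomorphic to $G$. $\mathrm{R}(G)$ is the ordinary (2-color, diagonal) Ramsey number of $G$. *)

theory Defs
  imports Main
begin

record 'a ugraph =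
  verts :: "'a set"
  edges :: "'a set set"

definition simple_graph :: "'a ugraph \<Rightarrow> bool" where
  "simple_graph G \<longleftrightarrow>
     finite (verts G) \<and> (\<forall>e \<in> edges G. e \<subseteq> verts G \<and> card e = 2)"

definition degree :: "'a ugraph \<Rightarrow> 'a \<Rightarrow> nat" where
  "degree G v = card {e \<in> edges G. v \<in> e}"

definition subgraph :: "'a ugraph \<Rightarrow> 'a ugraph \<Rightarrow> bool" where
  "subgraph H F \<longleftrightarrow> simple_graph H \<and> verts H \<subseteq> verts F \<and> edges H \<subseteq> edges F"

definition isomorphic :: "'a ugraph \<Rightarrow> 'b ugraph \<Rightarrow> bool" where
  "isomorphic G H \<longleftrightarrow>
     (\<exists>f. bij_betw f (verts G) (verts H) \<and> edges H = (\<lambda>e. f ` e) ` edges G)"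

text \<open>Degrees are taken in the host graph \<open>F\<close>, not in \<open>H\<close>.\<close>

definition singular :: "'a ugraph \<Rightarrow> 'a ugraph \<Rightarrow> bool" where
  "singular F H \<longleftrightarrow>
     (\<forall>u \<in> verts H. \<forall>v \<in> verts H. degree F u = degree F v) \<or>
     (\<forall>u \<in> verts H. \<forall>v \<in> verts H. u \<noteq> v \<longrightarrow> degree F u \<noteq> degree F v)"

definition complete_graph :: "nat \<Rightarrow> nat ugraph" where
  "complete_graph m = \<lparr>verts = {..<m}, edges = {e. e \<subseteq> {..<m} \<and> card e = 2}\<rparr>"

definition star :: "nat \<Rightarrow> nat ugraph" where
  "star s = \<lparr>verts = {0..s}, edges = {{0, i} | i. i \<in> {1..s}}\<rparr>"

text \<open>
  An edge 2-coloring is a function \<open>c\<close> into \<open>bool\<close>; its values outside the edge set of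
  the complete graph play no role. The host graph of a color is spanning: it keeps all
  \<open>m\<close> vertices, including those that are isolated in that color.
\<close>

definition host_graph :: "nat \<Rightarrow> (nat set \<Rightarrow> bool) \<Rightarrow> bool \<Rightarrow> nat ugraph" where
  "host_graph m c b =
     \<lparr>verts = verts (complete_graph m), edges = {e \<in> edges (complete_graph m). c e = b}\<rparr>"

definition ramsey_number :: "'a ugraph \<Rightarrow> nat" where
  "ramsey_number G =
     (LEAST N. \<forall>c. \<exists>b H. subgraph H (host_graph N c b) \<and> isomorphic G H)"

definition singular_ramsey_number :: "'a ugraph \<Rightarrow> nat" where
  "singular_ramsey_number G =
     (LEAST N. \<forall>m \<ge> N. \<forall>c. \<exists>b H. subgraph H (host_graph m c b) \<and>
        singular (host_graph m c b) H \<and> isomorphic G H)"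

end

theory Submission
  imports Defs
begin

text \<open>
  Writing \<open>k = s - 1\<close>, the ordinary Ramsey number is \<open>2k + 1\<close>. A colouring of \<open>K\<^bsub>2k+1\<^esub>\<close> without a
  monochromatic star would have to be \<open>k\<close>-regular in both colours, which the handshake lemma
  forbids: \<open>k\<close> is odd because \<open>s\<close> is even, and so is \<open>2k + 1\<close>. Colouring an edge of \<open>K\<^bsub>2k\<^esub>\<close> by whether its ends have the same
  parity shows that one vertex less does not suffice (\<open>ramsey_number_star\<close>).

  For the upper bound on the singular Ramsey number, the two degrees of a vertex determine each
  other, so both colours split the vertices into the same degree classes. Among more than
  \<open>(2k)\<^sup>2\<close> vertices there are \<open>2k + 1\<close> that lie in one class or in pairwise different classes, and the
  ordinary Ramsey argument applied to these finds a singular star (\<open>singular_star_exists\<close>).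

  The lower bound needs a colouring of \<open>(2k)\<^sup>2\<close> vertices with \<open>2k\<close> degree classes of size \<open>2k\<close>.
  Take \<open>2k\<close> blocks of \<open>2k\<close> vertices and group the blocks into pairs, an even one and an odd one
  in each. Edges between different pairs are red exactly if both blocks have the same type, so
  every vertex sees \<open>k - 1\<close> entirely red and \<open>k - 1\<close> entirely blue blocks; including its partner
  block, no colour reaches more than \<open>k\<close> other blocks. Inside a block, red is either complete
  bipartite or the complement of that, so no star with \<open>k + 1\<close> edges of one colour fits into a
  block. What is left is to make the degrees of the blocks distinct: between the two blocks of
  pair \<open>i\<close>, red is regular of degree \<open>2i\<close>, and the two kinds of block interiors contribute \<open>k\<close> and
  \<open>k - 1\<close>, so the red degrees \<open>(k - 1) \<sqdot> 2k + 2i + k\<close> and \<open>(k - 1) \<sqdot> 2k + 2i + k - 1\<close> never repeat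
  (\<open>red_degree\<close>, \<open>no_singular_star\<close>).
\<close>

section \<open>Stars in edge-coloured complete graphs\<close>

definition neighbours :: "nat \<Rightarrow> (nat set \<Rightarrow> bool) \<Rightarrow> bool \<Rightarrow> nat \<Rightarrow> nat set" where
  "neighbours m c b v = {w. w < m \<and> w \<noteq> v \<and> c {v, w} = b}"

definition singular_on :: "('a \<Rightarrow> 'b) \<Rightarrow> 'a set \<Rightarrow> bool" where
  "singular_on f V \<longleftrightarrow> (\<forall>u\<in>V. \<forall>v\<in>V. f u = f v) \<or> inj_on f V"

lemma singular_iff: "singular F H \<longleftrightarrow> singular_on (degree F) (verts H)"
  unfolding singular_def singular_on_def inj_on_def by blast

lemma singular_on_subset: "singular_on f V \<Longrightarrow> W \<subseteq> V \<Longrightarrow> singular_on f W"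
  unfolding singular_on_def by (meson inj_on_subset subsetD)

lemma finite_neighbours [simp]: "finite (neighbours m c b v)"
  unfolding neighbours_def by simp

lemma host_edges:
  "e \<in> edges (host_graph m c b) \<longleftrightarrow> e \<subseteq> {..<m} \<and> card e = 2 \<and> c e = b"
  unfolding host_graph_def complete_graph_def by auto

lemma host_verts: "verts (host_graph m c b) = {..<m}"
  unfolding host_graph_def complete_graph_def by simp

lemma degree_host_graph:
  assumes "v < m"
  shows "degree (host_graph m c b) v = card (neighbours m c b v)"
proof -
  have "bij_betw (\<lambda>w. {v, w}) (neighbours m c b v) {e \<in> edges (host_graph m c b). v \<in> e}"
    unfolding bij_betw_def
  proof
    show "inj_on (\<lambda>w. {v, w}) (neighbours m c b v)"
      by (auto simp: inj_on_def neighbours_def doubleton_eq_iff)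
    show "(\<lambda>w. {v, w}) ` neighbours m c b v = {e \<in> edges (host_graph m c b). v \<in> e}"
    proof (intro equalityI subsetI)
      fix e assume "e \<in> (\<lambda>w. {v, w}) ` neighbours m c b v"
      then show "e \<in> {e \<in> edges (host_graph m c b). v \<in> e}"
        using assms by (auto simp: host_edges neighbours_def)
    next
      fix e assume e: "e \<in> {e \<in> edges (host_graph m c b). v \<in> e}"
      then obtain w where "e = {v, w}" "w \<noteq> v"
        by (auto simp: host_edges card_2_iff)
      with e show "e \<in> (\<lambda>w. {v, w}) ` neighbours m c b v"
        by (auto simp: host_edges neighbours_def)
    qed
  qed
  then show ?thesis
    unfolding degree_def by (simp add: bij_betw_same_card)
qed

text \<open>
  Singularity depends only on the vertex set of a copy of the star, so copies can be traded for
  a centre with a set of neighbours; the predicate \<open>P\<close> makes this usable for both kinds of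
  Ramsey number.
\<close>

lemma star_copy_iff:
  "(\<exists>H. subgraph H (host_graph m c b) \<and> P (verts H) \<and> isomorphic (star s) H) \<longleftrightarrow>
   (\<exists>z L. z < m \<and> L \<subseteq> neighbours m c b z \<and> card L = s \<and> P (insert z L))"
proof
  assume "\<exists>H. subgraph H (host_graph m c b) \<and> P (verts H) \<and> isomorphic (star s) H"
  then obtain H f where H: "subgraph H (host_graph m c b)" "P (verts H)"
    and f: "bij_betw f {0..s} (verts H)"
    and E: "edges H = (\<lambda>e. f ` e) ` {{0, i} | i. i \<in> {1..s}}"
    unfolding isomorphic_def star_def by auto
  have inj: "inj_on f {0..s}" and im: "f ` {0..s} = verts H"
    using f by (auto simp: bij_betw_def)
  have split: "{0..s} = insert 0 {1..s}" by auto
  have "f ` {1..s} \<subseteq> neighbours m c b (f 0)"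
  proof
    fix w assume "w \<in> f ` {1..s}"
    then obtain i where i: "i \<in> {1..s}" "w = f i" by auto
    then have "f ` {0, i} \<in> edges H" unfolding E by blast
    then have "{f 0, w} \<in> edges (host_graph m c b)"
      using H(1) i by (auto simp: subgraph_def)
    moreover have "f 0 \<noteq> w" using inj_onD[OF inj, of 0 i] i by auto
    ultimately show "w \<in> neighbours m c b (f 0)"
      by (auto simp: host_edges neighbours_def)
  qed
  moreover have "f 0 < m"
    using H(1) im by (auto simp: subgraph_def host_verts)
  moreover have "card (f ` {1..s}) = s"
    using card_image[OF inj_on_subset[OF inj, of "{1..s}"]] by auto
  moreover have "P (insert (f 0) (f ` {1..s}))"
    using H(2) im split by (metis image_insert)
  ultimately show "\<exists>z L. z < m \<and> L \<subseteq> neighbours m c b z \<and> card L = s \<and> P (insert z L)"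
    by blast
next
  assume "\<exists>z L. z < m \<and> L \<subseteq> neighbours m c b z \<and> card L = s \<and> P (insert z L)"
  then obtain z L where z: "z < m" and L: "L \<subseteq> neighbours m c b z" "card L = s"
    and P: "P (insert z L)"
    by blast
  have fin: "finite L" using L(1) finite_neighbours by (rule finite_subset)
  obtain g where g: "bij_betw g {1..s} L"
    using finite_same_card_bij[of "{1..s}" L] fin L(2) by auto
  define f where "f = g(0 := z)"
  define H where "H = \<lparr>verts = insert z L, edges = (\<lambda>l. {z, l}) ` L\<rparr>"
  have zL: "z \<notin> L" using L by (auto simp: neighbours_def)
  have gi: "inj_on g {1..s}" and gim: "g ` {1..s} = L" using g by (auto simp: bij_betw_def)
  have f0: "f 0 = z" and fi: "\<And>i. i \<in> {1..s} \<Longrightarrow> f i = g i" by (auto simp: f_def)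
  have split: "{0..s} = insert 0 {1..s}" by auto
  have fim: "f ` {1..s} = L" using fi gim by (metis image_cong)
  have "inj_on f {1..s}" using gi fi by (metis inj_on_cong)
  then have "bij_betw f {0..s} (insert z L)"
    unfolding bij_betw_def split using fim zL f0 by auto
  moreover have "(\<lambda>l. {z, l}) ` L = (\<lambda>e. f ` e) ` {{0, i} | i. i \<in> {1..s}}"
  proof -
    have "{{0, i} | i. i \<in> {1..s}} = (\<lambda>i. {0, i}) ` {1..s}" by auto
    then show ?thesis by (simp add: fim[symmetric] image_image f0)
  qed
  ultimately have "isomorphic (star s) H"
    unfolding isomorphic_def star_def H_def by auto
  moreover have "subgraph H (host_graph m c b)"
    using L z zL fin
    by (auto simp: subgraph_def simple_graph_def H_def host_edges host_verts neighbours_def card_2_iff)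
  moreover have "P (verts H)" using P by (simp add: H_def)
  ultimately show "\<exists>H. subgraph H (host_graph m c b) \<and> P (verts H) \<and> isomorphic (star s) H"
    by blast
qed

section \<open>The ordinary Ramsey number\<close>

text \<open>
  The handshake lemma: exchanging the components matches the ordered pairs with increasing
  components to those with decreasing components.
\<close>

lemma even_sum_degrees:
  fixes A :: "'a::linorder set"
  assumes fin: "finite A" and sym: "\<And>v w. R v w \<Longrightarrow> R w v"
  shows "even (\<Sum>v\<in>A. card {w \<in> A. w \<noteq> v \<and> R v w})"
proof -
  define X where "X = {p \<in> A \<times> A. fst p < snd p \<and> R (fst p) (snd p)}"
  define Y where "Y = {p \<in> A \<times> A. snd p < fst p \<and> R (fst p) (snd p)}"
  have "(\<Sum>v\<in>A. card {w \<in> A. w \<noteq> v \<and> R v w}) = card (SIGMA v:A. {w \<in> A. w \<noteq> v \<and> R v w})"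
    using fin by simp
  also have "(SIGMA v:A. {w \<in> A. w \<noteq> v \<and> R v w}) = X \<union> Y"
    by (auto simp: X_def Y_def)
  also have "card (X \<union> Y) = card X + card Y"
    using fin by (intro card_Un_disjoint) (auto simp: X_def Y_def)
  also have "Y = prod.swap ` X"
    using sym by (auto simp: X_def Y_def image_iff)
  also have "card (prod.swap ` X) = card X"
    by (rule card_image[OF inj_on_subset[OF inj_swap subset_UNIV]])
  finally show ?thesis by simp
qed

lemma star_in_odd_set:
  assumes A: "A \<subseteq> {..<m}" and card: "card A = 2 * k + 1" and odd: "odd k"
  shows "\<exists>b. \<exists>z\<in>A. \<exists>L. L \<subseteq> A \<inter> neighbours m c b z \<and> card L = k + 1"
proof (rule ccontr)
  assume neg: "\<not> ?thesis"
  have fin: "finite A" using A by (meson finite_lessThan finite_subset)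
  have le: "card (A \<inter> neighbours m c b z) \<le> k" if "z \<in> A" for b z
  proof (rule ccontr)
    assume "\<not> card (A \<inter> neighbours m c b z) \<le> k"
    then have "k + 1 \<le> card (A \<inter> neighbours m c b z)" by simp
    then obtain L where "L \<subseteq> A \<inter> neighbours m c b z" "card L = k + 1"
      by (metis obtain_subset_with_card_n)
    with neg that show False by blast
  qed
  \<comment> \<open>The two colours share the \<open>2k\<close> other vertices of \<open>A\<close>, at most \<open>k\<close> each.\<close>
  have eq: "card {w \<in> A. w \<noteq> v \<and> c {v, w}} = k" if v: "v \<in> A" for v
  proof -
    have "A - {v} = (A \<inter> neighbours m c True v) \<union> (A \<inter> neighbours m c False v)"
      using A by (auto simp: neighbours_def)
    then have "card (A - {v}) = card (A \<inter> neighbours m c True v) + card (A \<inter> neighbours m c False v)"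
      using fin by (simp, intro card_Un_disjoint) (auto simp: neighbours_def)
    moreover have "card (A - {v}) = 2 * k" using card v fin by simp
    ultimately have "card (A \<inter> neighbours m c True v) = k"
      using le[OF v, of True] le[OF v, of False] by linarith
    moreover have "A \<inter> neighbours m c True v = {w \<in> A. w \<noteq> v \<and> c {v, w}}"
      using A by (auto simp: neighbours_def)
    ultimately show ?thesis by simp
  qed
  have "even (\<Sum>v\<in>A. card {w \<in> A. w \<noteq> v \<and> c {v, w}})"
    by (rule even_sum_degrees[OF fin]) (simp add: insert_commute)
  moreover have "(\<Sum>v\<in>A. card {w \<in> A. w \<noteq> v \<and> c {v, w}}) = (2 * k + 1) * k"
    using eq card by simp
  ultimately show False using odd by simp
qed

text \<open>
  Halving is injective on numbers of one parity, which bounds the sizes of the stars in both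
  lower-bound constructions.
\<close>

lemma card_le_by_halves:
  fixes L :: "'a set" and h :: "'a \<Rightarrow> nat"
  assumes "inj_on h L"
    and "\<And>w. w \<in> L \<Longrightarrow> h w < 2 * k"
    and "\<And>w w'. w \<in> L \<Longrightarrow> w' \<in> L \<Longrightarrow> h w div 2 = h w' div 2 \<Longrightarrow> h w mod 2 = h w' mod 2"
  shows "card L \<le> k"
proof -
  have "inj_on (\<lambda>w. h w div 2) L"
    using assms(1,3) by (intro inj_onI) (metis inj_onD div_mult_mod_eq)
  moreover have "(\<lambda>w. h w div 2) ` L \<subseteq> {..<k}"
    using assms(2) by (auto simp: less_mult_imp_div_less mult.commute)
  ultimately show ?thesis using card_inj_on_le[of _ L "{..<k}"] by auto
qed

lemma ramsey_number_star:
  assumes "odd k"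
  shows "ramsey_number (star (k + 1)) = 2 * k + 1"
proof -
  have iff: "(\<exists>H. subgraph H (host_graph N c b) \<and> isomorphic (star (k + 1)) H) \<longleftrightarrow>
      (\<exists>z L. z < N \<and> L \<subseteq> neighbours N c b z \<and> card L = k + 1)" for N c b
    using star_copy_iff[of N c b "\<lambda>_. True" "k + 1"] by simp
  show ?thesis
    unfolding ramsey_number_def iff
  proof (rule Least_equality)
    show "\<forall>c. \<exists>b z L. z < 2 * k + 1 \<and> L \<subseteq> neighbours (2 * k + 1) c b z \<and> card L = k + 1"
    proof
      fix c
      show "\<exists>b z L. z < 2 * k + 1 \<and> L \<subseteq> neighbours (2 * k + 1) c b z \<and> card L = k + 1"
        using star_in_odd_set[of "{..<2 * k + 1}" "2 * k + 1" k c] assms by auto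
    qed
  next
    fix N
    assume N: "\<forall>c. \<exists>b z L. z < N \<and> L \<subseteq> neighbours N c b z \<and> card L = k + 1"
    show "2 * k + 1 \<le> N"
    proof (rule ccontr)
      assume less: "\<not> 2 * k + 1 \<le> N"
      define c :: "nat set \<Rightarrow> bool" where "c e \<longleftrightarrow> (\<exists>v\<in>e. \<exists>w\<in>e. v mod 2 \<noteq> w mod 2)" for e
      obtain b z L where L: "L \<subseteq> neighbours N c b z" "card L = k + 1"
        using spec[OF N, of c] by blast
      have "card L \<le> k"
      proof (rule card_le_by_halves[of id])
        show "id w < 2 * k" if "w \<in> L" for w
          using that L less by (auto simp: neighbours_def)
        have "(w mod 2 \<noteq> z mod 2) = b" if "w \<in> L" for w
          using that L by (auto simp: neighbours_def c_def)
        then show "id w mod 2 = id w' mod 2" if "w \<in> L" "w' \<in> L" for w w'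
          using that by (metis id_apply mod2_eq_if)
      qed simp
      with L show False by simp
    qed
  qed
qed

section \<open>Singular stars in large complete graphs\<close>

text \<open>
  Pigeonhole: either \<open>f\<close> takes more than \<open>n\<close> values, and representatives of them are a set on
  which it is injective, or at most \<open>n\<close> fibres cover \<open>A\<close> and one of them has more than \<open>n\<close>
  elements.
\<close>

lemma singular_subset_exists:
  assumes fin: "finite A" and large: "n\<^sup>2 < card A"
  shows "\<exists>B\<subseteq>A. card B = n + 1 \<and> singular_on f B"
proof (cases "n + 1 \<le> card (f ` A)")
  case True
  then obtain T where T: "T \<subseteq> f ` A" "card T = n + 1"
    using obtain_subset_with_card_n[OF True] by metis
  then obtain B where B: "B \<subseteq> A" "inj_on f B" "f ` B = T"
    by (metis subset_image_inj)
  then have "card B = n + 1" using T(2) card_image by metis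
  with B show ?thesis unfolding singular_on_def by blast
next
  case False
  have "\<exists>d\<in>f ` A. n + 1 \<le> card {v \<in> A. f v = d}"
  proof (rule ccontr)
    assume neg: "\<not> ?thesis"
    have "card A = card (\<Union>d\<in>f ` A. {v \<in> A. f v = d})"
      by (rule arg_cong[of _ _ card]) auto
    also have "\<dots> \<le> (\<Sum>d\<in>f ` A. card {v \<in> A. f v = d})"
      using fin by (intro card_UN_le) simp
    also have "\<dots> \<le> (\<Sum>d\<in>f ` A. n)"
      using neg by (intro sum_mono) force
    also have "\<dots> \<le> n * n"
      using False by simp
    finally show False using large by (simp add: power2_eq_square)
  qed
  then obtain d where d: "n + 1 \<le> card {v \<in> A. f v = d}" by blast
  obtain B where "B \<subseteq> {v \<in> A. f v = d}" "card B = n + 1"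
    using obtain_subset_with_card_n[OF d] by metis
  then show ?thesis unfolding singular_on_def by blast
qed

text \<open>
  The degrees in the two colours add up to \<open>m - 1\<close>, so they induce the same notion of
  singularity.
\<close>

lemma degree_host_graph_False:
  assumes "v < m"
  shows "degree (host_graph m c False) v = m - 1 - degree (host_graph m c True) v"
    and "degree (host_graph m c True) v \<le> m - 1"
proof -
  have "{..<m} - {v} = neighbours m c True v \<union> neighbours m c False v"
    by (auto simp: neighbours_def)
  then have "card ({..<m} - {v}) = card (neighbours m c True v) + card (neighbours m c False v)"
    by (simp, intro card_Un_disjoint) (auto simp: neighbours_def)
  moreover have "card ({..<m} - {v}) = m - 1" using assms by simp
  ultimately show "degree (host_graph m c False) v = m - 1 - degree (host_graph m c True) v"
    "degree (host_graph m c True) v \<le> m - 1"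
    using assms by (simp_all add: degree_host_graph)
qed

lemma degree_host_graph_eq_iff:
  assumes "u < m" "v < m"
  shows "degree (host_graph m c b) u = degree (host_graph m c b) v \<longleftrightarrow>
         degree (host_graph m c True) u = degree (host_graph m c True) v"
proof (cases b)
  case False
  then show ?thesis
    using degree_host_graph_False[OF assms(1), of c] degree_host_graph_False[OF assms(2), of c]
    by auto
qed simp

lemma singular_on_host_graph_iff:
  assumes "V \<subseteq> {..<m}"
  shows "singular_on (degree (host_graph m c b)) V \<longleftrightarrow> singular_on (degree (host_graph m c True)) V"
proof -
  have "degree (host_graph m c b) u = degree (host_graph m c b) v \<longleftrightarrow>
      degree (host_graph m c True) u = degree (host_graph m c True) v" if "u \<in> V" "v \<in> V" for u v
    using that assms by (intro degree_host_graph_eq_iff) auto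
  then show ?thesis unfolding singular_on_def inj_on_def by blast
qed

lemma singular_star_exists:
  assumes "odd k" and m: "(2 * k)\<^sup>2 < m"
  shows "\<exists>b z L. z < m \<and> L \<subseteq> neighbours m c b z \<and> card L = k + 1 \<and>
           singular_on (degree (host_graph m c b)) (insert z L)"
proof -
  obtain A where A: "A \<subseteq> {..<m}" "card A = 2 * k + 1"
    "singular_on (degree (host_graph m c True)) A"
    using singular_subset_exists[of "{..<m}" "2 * k"] m by auto
  then obtain b z L where L: "z \<in> A" "L \<subseteq> A \<inter> neighbours m c b z" "card L = k + 1"
    using star_in_odd_set[of A m k c] assms by blast
  have "singular_on (degree (host_graph m c b)) A"
    using A singular_on_host_graph_iff by blast
  then have "singular_on (degree (host_graph m c b)) (insert z L)"
    using L by (auto intro: singular_on_subset)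
  with A L show ?thesis by blast
qed

section \<open>A colouring without singular stars\<close>

text \<open>
  The blocks of the colouring are the intervals of length \<open>n = 2k\<close>; vertex \<open>v\<close> is number
  \<open>v mod n\<close> in block \<open>v div n\<close>, and blocks \<open>2i\<close> and \<open>2i + 1\<close> form pair \<open>i\<close>. The condition
  \<open>(x + y) mod n < 2i\<close> is a symmetric description of a \<open>2i\<close>-regular bipartite graph.
\<close>

definition red_at :: "nat \<Rightarrow> nat \<Rightarrow> nat \<Rightarrow> nat \<Rightarrow> nat \<Rightarrow> bool" where
  "red_at n C x D y \<longleftrightarrow>
     (if C = D then (x mod 2 \<noteq> y mod 2) = even C
      else if C div 2 = D div 2 then (x + y) mod n < 2 * (C div 2)
      else C mod 2 = D mod 2)"

definition red :: "nat \<Rightarrow> nat \<Rightarrow> nat \<Rightarrow> bool" where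
  "red n v w \<longleftrightarrow> red_at n (v div n) (v mod n) (w div n) (w mod n)"

definition block_colouring :: "nat \<Rightarrow> nat set \<Rightarrow> bool" where
  "block_colouring n e \<longleftrightarrow> (\<exists>v\<in>e. \<exists>w\<in>e. v \<noteq> w \<and> red n v w)"

lemma red_sym: "red n v w \<longleftrightarrow> red n w v"
  unfolding red_def red_at_def by (auto simp: add.commute)

lemma block_colouring_edge: "v \<noteq> w \<Longrightarrow> block_colouring n {v, w} \<longleftrightarrow> red n v w"
  unfolding block_colouring_def using red_sym by auto

lemma neighbours_block_colouring:
  "neighbours m (block_colouring n) b v = {w. w < m \<and> w \<noteq> v \<and> red n v w = b}"
  unfolding neighbours_def using block_colouring_edge by metis

lemma card_square_by_blocks:
  fixes n :: nat
  assumes "n > 0"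
  shows "card {w. w < n * n \<and> P (w div n) (w mod n)} = (\<Sum>D<n. card {y. y < n \<and> P D y})"
proof -
  have "bij_betw (\<lambda>(D, y). D * n + y) (SIGMA D:{..<n}. {y. y < n \<and> P D y})
      {w. w < n * n \<and> P (w div n) (w mod n)}"
  proof (rule bij_betw_byWitness[where f' = "\<lambda>w. (w div n, w mod n)"])
    show "(\<lambda>(D, y). D * n + y) ` (SIGMA D:{..<n}. {y. y < n \<and> P D y})
        \<subseteq> {w. w < n * n \<and> P (w div n) (w mod n)}"
    proof clarsimp
      fix D y assume "D < n" "y < n"
      then have "D * n + y < Suc D * n" by simp
      also have "\<dots> \<le> n * n" using \<open>D < n\<close> by (intro mult_le_mono1) simp
      finally show "D * n + y < n * n" .
    qed
    show "(\<lambda>w. (w div n, w mod n)) ` {w. w < n * n \<and> P (w div n) (w mod n)}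
        \<subseteq> (SIGMA D:{..<n}. {y. y < n \<and> P D y})"
      using assms by (auto simp: less_mult_imp_div_less)
  qed auto
  then show ?thesis
    by (simp add: bij_betw_same_card[symmetric])
qed

lemma sum_by_pairs: "(\<Sum>D<2 * k. f D) = (\<Sum>j<k. f (2 * j) + f (2 * j + 1 :: nat) :: nat)"
  by (induction k) auto

lemma card_parity: "r < 2 \<Longrightarrow> card {y. y < 2 * k \<and> y mod 2 = r} = (k :: nat)"
proof -
  assume r: "r < 2"
  have "{y. y < 2 * k \<and> y mod 2 = r} = (\<lambda>j. 2 * j + r) ` {..<k}"
  proof (intro equalityI subsetI)
    fix y assume "y \<in> {y. y < 2 * k \<and> y mod 2 = r}"
    then have "y = 2 * (y div 2) + r" "y div 2 < k" by auto
    then show "y \<in> (\<lambda>j. 2 * j + r) ` {..<k}" by blast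
  qed (use r in auto)
  moreover have "inj (\<lambda>j. 2 * j + r)" by (simp add: inj_def)
  ultimately show ?thesis by (simp add: card_image inj_on_subset)
qed

lemma card_rotation:
  fixes n x t :: nat
  assumes "n > 0" "t \<le> n"
  shows "card {y. y < n \<and> (x + y) mod n < t} = t"
proof -
  have inj: "inj_on (\<lambda>y. (x + y) mod n) {..<n}"
  proof (rule linorder_inj_onI')
    fix y z assume y: "y \<in> {..<n}" and z: "z \<in> {..<n}" and "y < z"
    show "(x + y) mod n \<noteq> (x + z) mod n"
    proof
      assume "(x + y) mod n = (x + z) mod n"
      then have "n dvd z - y"
        using mod_eq_dvd_iff_nat[of "x + y" "x + z" n] \<open>y < z\<close> by simp
      then show False using \<open>y < z\<close> z dvd_imp_le[of n "z - y"] by simp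
    qed
  qed
  have surj: "(\<lambda>y. (x + y) mod n) ` {..<n} = {..<n}"
    using assms inj by (intro endo_inj_surj) auto
  have "(\<lambda>y. (x + y) mod n) ` {y. y < n \<and> (x + y) mod n < t} =
      (\<lambda>y. (x + y) mod n) ` {..<n} \<inter> {..<t}"
    by auto
  also have "\<dots> = {..<t}"
    unfolding surj using assms(2) by auto
  finally have "(\<lambda>y. (x + y) mod n) ` {y. y < n \<and> (x + y) mod n < t} = {..<t}" .
  moreover have "inj_on (\<lambda>y. (x + y) mod n) {y. y < n \<and> (x + y) mod n < t}"
    using inj by (rule inj_on_subset) auto
  ultimately show ?thesis
    using card_image[of "\<lambda>y. (x + y) mod n" "{y. y < n \<and> (x + y) mod n < t}"] by simp
qed

text \<open>
  Each of the other \<open>k - 1\<close> pairs contributes exactly one entirely red block, the partner block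
  \<open>2i\<close> red neighbours, and the block itself \<open>k\<close> or, if its number is odd, \<open>k - 1\<close>. The parity of
  the block number stands on the left-hand side to avoid truncated subtraction.
\<close>

lemma red_degree:
  assumes n: "n = 2 * k" and v: "v < n * n"
  shows "degree (host_graph (n * n) (block_colouring n) True) v + v div n mod 2 =
         (k - 1) * n + k + 2 * (v div n div 2)"
proof -
  define C x where "C = v div n" and "x = v mod n"
  define i where "i = C div 2"
  have npos: "n > 0" using v by (cases n) auto
  have C: "C < n" using v by (simp add: C_def less_mult_imp_div_less)
  have x: "x < n" using npos by (simp add: x_def)
  have i: "i < k" using C n by (simp add: i_def less_mult_imp_div_less mult.commute)
  define g where "g D = card {y. y < n \<and> \<not> (D = C \<and> y = x) \<and> red_at n C x D y}" for D
  have "w \<noteq> v \<longleftrightarrow> \<not> (w div n = C \<and> w mod n = x)" for w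
    unfolding C_def x_def by (metis div_mult_mod_eq)
  then have "neighbours (n * n) (block_colouring n) True v =
      {w. w < n * n \<and> \<not> (w div n = C \<and> w mod n = x) \<and> red_at n C x (w div n) (w mod n)}"
    by (simp add: neighbours_block_colouring red_def C_def x_def)
  then have deg: "degree (host_graph (n * n) (block_colouring n) True) v = (\<Sum>D<n. g D)"
    using card_square_by_blocks[OF npos, of "\<lambda>D y. \<not> (D = C \<and> y = x) \<and> red_at n C x D y"] v
    by (simp add: degree_host_graph g_def)
  have inner: "g C + C mod 2 = k"
  proof (cases "even C")
    case True
    then have "{y. y < n \<and> \<not> (C = C \<and> y = x) \<and> red_at n C x C y} =
        {y. y < 2 * k \<and> y mod 2 = 1 - x mod 2}"
      by (auto simp: red_at_def n) presburger+
    then show ?thesis using True card_parity[of "1 - x mod 2" k] by (simp add: g_def)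
  next
    case False
    then have "{y. y < n \<and> \<not> (C = C \<and> y = x) \<and> red_at n C x C y} =
        {y. y < 2 * k \<and> y mod 2 = x mod 2} - {x}"
      by (auto simp: red_at_def n)
    then have "g C = k - 1"
      using x card_parity[of "x mod 2" k] by (simp add: g_def n)
    then show ?thesis using False i by (simp add: odd_iff_mod_2_eq_one)
  qed
  have partner: "g D = 2 * i" if "D div 2 = i" "D \<noteq> C" for D
    using that card_rotation[OF npos, of "2 * i" x] i n
    by (simp add: g_def red_at_def i_def)
  have far: "g D = (if D mod 2 = C mod 2 then n else 0)" if "D div 2 \<noteq> i" for D
  proof -
    have "C \<noteq> D" using that by (auto simp: i_def)
    then show ?thesis using that by (auto simp: g_def red_at_def i_def)
  qed
  have "(\<Sum>D<n. g D) = (\<Sum>j<k. g (2 * j) + g (2 * j + 1))"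
    unfolding n by (rule sum_by_pairs)
  also have "\<dots> = g (2 * i) + g (2 * i + 1) + (\<Sum>j\<in>{..<k} - {i}. g (2 * j) + g (2 * j + 1))"
    using i by (simp add: sum.remove)
  also have "(\<Sum>j\<in>{..<k} - {i}. g (2 * j) + g (2 * j + 1)) = (\<Sum>j\<in>{..<k} - {i}. n)"
  proof (rule sum.cong)
    fix j assume "j \<in> {..<k} - {i}"
    then show "g (2 * j) + g (2 * j + 1) = n"
      using far[of "2 * j"] far[of "2 * j + 1"] by auto
  qed simp
  also have "\<dots> = (k - 1) * n" using i by simp
  also have "g (2 * i) + g (2 * i + 1) = g C + 2 * i"
  proof (cases "even C")
    case True
    then have "C = 2 * i" by (simp add: i_def)
    then show ?thesis using partner[of "2 * i + 1"] by simp
  next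
    case False
    then have "C = 2 * i + 1" by (simp add: i_def)
    then show ?thesis using partner[of "2 * i"] by simp
  qed
  finally show ?thesis using deg inner unfolding C_def i_def by linarith
qed

text \<open>
  With \<open>C = 2i + p\<close> the number of the block, the red degree is a constant plus \<open>2i - p\<close>, and
  this determines \<open>C\<close>.
\<close>

lemma same_degree_iff_same_block:
  assumes n: "n = 2 * k" and u: "u < n * n" and v: "v < n * n"
  shows "degree (host_graph (n * n) (block_colouring n) b) u =
         degree (host_graph (n * n) (block_colouring n) b) v \<longleftrightarrow> u div n = v div n"
proof -
  define d where "d = degree (host_graph (n * n) (block_colouring n) True)"
  have "d u = d v \<longleftrightarrow> u div n = v div n"
  proof
    assume eq: "d u = d v"
    have cancel: "p + i' = p' + i" if "e + p = K + i" "e + p' = K + i'" for e p p' K i i' :: nat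
      using that by linarith
    have "u div n mod 2 + 2 * (v div n div 2) = v div n mod 2 + 2 * (u div n div 2)"
      using red_degree[OF n u] red_degree[OF n v] unfolding d_def[symmetric] eq by (rule cancel)
    moreover have "C = D" if "C mod 2 + 2 * (D div 2) = D mod 2 + 2 * (C div 2)" for C D :: nat
    proof -
      have "C mod 2 = D mod 2" using arg_cong[OF that, of "\<lambda>a. a mod 2"] by simp
      moreover from this have "C div 2 = D div 2" using that by simp
      ultimately show ?thesis by (metis div_mult_mod_eq)
    qed
    ultimately show "u div n = v div n" by blast
  next
    assume "u div n = v div n"
    then show "d u = d v"
      using red_degree[OF n u] red_degree[OF n v] unfolding d_def by simp
  qed
  with degree_host_graph_eq_iff[OF u v, of "block_colouring n" b] show ?thesis
    unfolding d_def by (rule trans)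
qed

lemma no_singular_star:
  assumes n: "n = 2 * k" and z: "z < n * n"
    and L: "L \<subseteq> neighbours (n * n) (block_colouring n) b z"
    and sing: "singular_on (degree (host_graph (n * n) (block_colouring n) b)) (insert z L)"
  shows "card L \<le> k"
proof -
  have npos: "n > 0" using z by (cases n) auto
  have Lw: "w < n * n" "w \<noteq> z" "red n z w = b" if "w \<in> L" for w
    using that L by (auto simp: neighbours_block_colouring)
  define d where "d = degree (host_graph (n * n) (block_colouring n) b)"
  have deg: "d u = d v \<longleftrightarrow> u div n = v div n" if "u \<in> insert z L" "v \<in> insert z L" for u v
    unfolding d_def using that z Lw(1) by (intro same_degree_iff_same_block[OF n]) auto
  have "(\<forall>w\<in>L. w div n = z div n) \<or> inj_on (\<lambda>w. w div n) (insert z L)"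
    using sing[folded d_def] unfolding singular_on_def
  proof
    assume "\<forall>u\<in>insert z L. \<forall>v\<in>insert z L. d u = d v"
    then have "\<forall>w\<in>L. w div n = z div n" using deg by blast
    then show ?thesis ..
  next
    assume "inj_on d (insert z L)"
    then have "inj_on (\<lambda>w. w div n) (insert z L)" using deg by (meson inj_on_def)
    then show ?thesis ..
  qed
  then consider
      (same) "\<forall>w\<in>L. w div n = z div n"
    | (distinct) "inj_on (\<lambda>w. w div n) (insert z L)"
    by blast
  then show ?thesis
  proof cases
    case same
    \<comment> \<open>Inside a block, the colour of an edge at \<open>z\<close> fixes the parity of its other end.\<close>
    show ?thesis
    proof (rule card_le_by_halves[of "\<lambda>w. w mod n"])
      show "inj_on (\<lambda>w. w mod n) L"
        using same by (intro inj_onI) (metis div_mult_mod_eq)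
      show "w mod n < 2 * k" for w using npos n by simp
      have "(z mod n mod 2 \<noteq> w mod n mod 2) = (even (z div n) = b)" if "w \<in> L" for w
        using Lw(3)[OF that] same that by (auto simp: red_def red_at_def)
      then show "w mod n mod 2 = w' mod n mod 2" if "w \<in> L" "w' \<in> L" for w w'
        using that by (metis mod2_eq_if)
    qed
  next
    case distinct
    \<comment> \<open>The leaves lie in different blocks, and at most one of them in each pair of blocks: in the
      pair of \<open>z\<close> only the partner block is left, and in any other pair the colour fixes the block.\<close>
    have block: "w div n \<noteq> z div n" if "w \<in> L" for w
      using inj_onD[OF distinct, of w z] that Lw(2)[OF that] by auto
    show ?thesis
    proof (rule card_le_by_halves[of "\<lambda>w. w div n"])
      show "inj_on (\<lambda>w. w div n) L" using distinct by (rule inj_on_subset) auto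
      show "w div n < 2 * k" if "w \<in> L" for w
        using Lw(1)[OF that] n by (simp add: less_mult_imp_div_less)
      fix w w' assume w: "w \<in> L" "w' \<in> L" and same_pair: "w div n div 2 = w' div n div 2"
      show "w div n mod 2 = w' div n mod 2"
      proof (cases "w div n div 2 = z div n div 2")
        case True
        have "w div n mod 2 \<noteq> z div n mod 2" "w' div n mod 2 \<noteq> z div n mod 2"
          using True same_pair block[OF w(1)] block[OF w(2)] by (metis div_mult_mod_eq)+
        then show ?thesis by (metis mod2_eq_if)
      next
        case False
        then have "(z div n mod 2 = w div n mod 2) = b" "(z div n mod 2 = w' div n mod 2) = b"
          using Lw(3)[OF w(1)] Lw(3)[OF w(2)] block[OF w(1)] block[OF w(2)] same_pair
          by (auto simp: red_def red_at_def split: if_splits)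
        then show ?thesis by (metis mod2_eq_if)
      qed
    qed
  qed
qed

section \<open>The singular Ramsey number\<close>

lemma singular_ramsey_number_star:
  assumes "odd k"
  shows "singular_ramsey_number (star (k + 1)) = (2 * k)\<^sup>2 + 1"
proof -
  have iff: "(\<exists>H. subgraph H (host_graph m c b) \<and> singular (host_graph m c b) H \<and>
        isomorphic (star (k + 1)) H) \<longleftrightarrow>
      (\<exists>z L. z < m \<and> L \<subseteq> neighbours m c b z \<and> card L = k + 1 \<and>
        singular_on (degree (host_graph m c b)) (insert z L))" for m c b
    unfolding singular_iff by (rule star_copy_iff)
  show ?thesis
    unfolding singular_ramsey_number_def iff
  proof (rule Least_equality)
    show "\<forall>m\<ge>(2 * k)\<^sup>2 + 1. \<forall>c. \<exists>b z L. z < m \<and> L \<subseteq> neighbours m c b z \<and> card L = k + 1 \<and>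
        singular_on (degree (host_graph m c b)) (insert z L)"
    proof (intro allI impI)
      fix m c assume "(2 * k)\<^sup>2 + 1 \<le> m"
      then have "(2 * k)\<^sup>2 < m" by simp
      then show "\<exists>b z L. z < m \<and> L \<subseteq> neighbours m c b z \<and> card L = k + 1 \<and>
          singular_on (degree (host_graph m c b)) (insert z L)"
        by (rule singular_star_exists[OF assms])
    qed
  next
    fix N
    assume N: "\<forall>m\<ge>N. \<forall>c. \<exists>b z L. z < m \<and> L \<subseteq> neighbours m c b z \<and> card L = k + 1 \<and>
        singular_on (degree (host_graph m c b)) (insert z L)"
    show "(2 * k)\<^sup>2 + 1 \<le> N"
    proof (rule ccontr)
      define n where "n = 2 * k"
      assume "\<not> (2 * k)\<^sup>2 + 1 \<le> N"
      then have "N \<le> n * n" by (simp add: n_def power2_eq_square)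
      from N[rule_format, OF this, of "block_colouring n"] obtain b z L where L: "z < n * n" "L \<subseteq> neighbours (n * n) (block_colouring n) b z"
        "singular_on (degree (host_graph (n * n) (block_colouring n) b)) (insert z L)"
        and card: "card L = k + 1"
        by blast
      then show False using no_singular_star[OF n_def L] by simp
    qed
  qed
qed

theorem proposition35:
  fixes s :: nat
  assumes "s \<ge> 2" and "even s"
  shows "singular_ramsey_number (star s) = (ramsey_number (star s) - 1)\<^sup>2 + 1 \<and>
         (ramsey_number (star s) - 1)\<^sup>2 + 1 = (2 * s - 2)\<^sup>2 + 1"
proof -
  define k where "k = s - 1"
  have s: "s = k + 1" using assms(1) by (simp add: k_def)
  have odd: "odd k" using assms(2) by (simp add: s)
  show ?thesis
    unfolding s ramsey_number_star[OF odd] singular_ramsey_number_star[OF odd] by simp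
qed

end
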